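(* Let $V$ be a real separable Hilbert space and let $a,b,m$ be symmetric bilinear forms on $V$ such that $a$ is continuous and $V$-coercive, $b$ is weakly continuous, and $m$ is weakly continuous with $m(u,u)>0$ for all nonzero $u\in V$. Let $\mathcal B(u):=b(u,u)$ for $u\in V$, and let $\mu_k(\lambda)$ be the $k$-th variational eigencurve associated with $(a,b,m)$. (i) If $\hat v_1,\dots,\hat v_k\in V$ are $k$ linearly independent vectors at which $\mathcal B$ is strictly positive, then $\lim_{\lambda\to\infty}\mu_k(\lambda)=-\infty$. (ii) If $\hat w_1,\dots,\hat w_k\in V$ are $k$ linearly independent vectors at which $\mathcal B$ is strictly negative, then $\lim_{\lambda\to-\infty}\mu_k(\lambda)=-\infty$.
   Context: "$a$ is continuous and $V$-coercive" means there are constants $0<\kappa_1\le\kappa_2<\infty$ with $\kappa_1\|u\|^2\le a(u,u)\le\kappa_2\|u\|^2$ for all $u\in V$. A symmetric bilinear form $b$ on $V$ is weakly continuous if $u_j\rightharpoonup u$ and $v_j\rightharpoonup v$ weakly in $V$ imply $b(u_j,v_j)\to b(u,v)$. For $\lambda\in\mathbb{R}$ and $k\in\mathbb{N}$ (with $k\le\dim V$ if $V$ is finite dimensional), $\mu_k(\lambda)$ is the $k$-th smallest, counted with multiplicity, of the real numbers $\mu$ for which there is a nonzero $u\in V$ with $a(u,v)-\lambda b(u,v)=\mu\,m(u,v)$ for all $v\in V$; equivalently $\mu_k(\lambda)=\inf_{Z_k}\sup_{0\ne v\in Z_k}\frac{a(v,v)-\lambda b(v,v)}{m(v,v)}$,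 the infimum being over all $k$-dimensional subspaces $Z_k$ of $V$. The graph of $\lambda\mapsto\mu_k(\lambda)$ is the $k$-th variational eigencurve.
   Formalization: Positivity (negativity) of B is required at every nonzero vector of the span of the k linearly independent vectors, not only at the vectors; otherwise false: V=R^2, a=m inner product, b=diag(1,-1), vectors (2,1),(2,-1) give mu_2=1+|lambda|. *)

theory Defs
  imports "HOL-Analysis.Analysis"
begin

definition symmetric_bilinear :: "('v::real_vector \<Rightarrow> 'v \<Rightarrow> real) \<Rightarrow> bool" where
  "symmetric_bilinear f \<longleftrightarrow> bilinear f \<and> (\<forall>u v. f u v = f v u)"

definition continuous_coercive :: "('v::real_inner \<Rightarrow> 'v \<Rightarrow> real) \<Rightarrow> bool" where
  "continuous_coercive a \<longleftrightarrow>
     (\<exists>\<kappa>1 \<kappa>2. 0 < \<kappa>1 \<and> \<kappa>1 \<le> \<kappa>2 \<and>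
        (\<forall>u. \<kappa>1 * (norm u)\<^sup>2 \<le> a u u \<and> a u u \<le> \<kappa>2 * (norm u)\<^sup>2))"

definition weakly_converges :: "(nat \<Rightarrow> 'v::real_normed_vector) \<Rightarrow> 'v \<Rightarrow> bool" where
  "weakly_converges u l \<longleftrightarrow>
     (\<forall>\<phi> :: 'v \<Rightarrow> real. bounded_linear \<phi> \<longrightarrow> (\<lambda>j. \<phi> (u j)) \<longlonglongrightarrow> \<phi> l)"

definition weakly_continuous_form :: "('v::real_normed_vector \<Rightarrow> 'v \<Rightarrow> real) \<Rightarrow> bool" where
  "weakly_continuous_form b \<longleftrightarrow>
     (\<forall>us vs u v. weakly_converges us u \<longrightarrow> weakly_converges vs v \<longrightarrow>
        (\<lambda>j. b (us j) (vs j)) \<longlonglongrightarrow> b u v)"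

definition eigenspace ::
  "('v::real_vector \<Rightarrow> 'v \<Rightarrow> real) \<Rightarrow> ('v \<Rightarrow> 'v \<Rightarrow> real) \<Rightarrow> ('v \<Rightarrow> 'v \<Rightarrow> real) \<Rightarrow>
   real \<Rightarrow> real \<Rightarrow> 'v set" where
  "eigenspace a b m lam \<mu> = {u. \<forall>v. a u v - lam * b u v = \<mu> * m u v}"

(* At least k eigenvalues lie in {..t}, each counted as often as the dimension of its eigenspace.
   Multiplicities are bounded from below by the sizes of independent sets, because "dim" is 0
   on infinite-dimensional spaces. Independent sets do not contain 0, so only eigenvalues
   contribute to the sum. *)
definition at_least_eigenvalues ::
  "('v::real_vector \<Rightarrow> 'v \<Rightarrow> real) \<Rightarrow> ('v \<Rightarrow> 'v \<Rightarrow> real) \<Rightarrow> ('v \<Rightarrow> 'v \<Rightarrow> real) \<Rightarrow>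
   real \<Rightarrow> nat \<Rightarrow> real \<Rightarrow> bool" where
  "at_least_eigenvalues a b m lam k t \<longleftrightarrow>
     (\<exists>F B. finite F \<and> F \<subseteq> {..t} \<and>
        (\<forall>\<mu>\<in>F. finite (B \<mu>) \<and> independent (B \<mu>) \<and> B \<mu> \<subseteq> eigenspace a b m lam \<mu>) \<and>
        k \<le> (\<Sum>\<mu>\<in>F. card (B \<mu>)))"

(* The k-th smallest eigenvalue counted with multiplicity, for 1 \<le> k (and k \<le> dim V if V is
   finite-dimensional). *)
definition eigencurve ::
  "('v::real_vector \<Rightarrow> 'v \<Rightarrow> real) \<Rightarrow> ('v \<Rightarrow> 'v \<Rightarrow> real) \<Rightarrow> ('v \<Rightarrow> 'v \<Rightarrow> real) \<Rightarrow>
   nat \<Rightarrow> real \<Rightarrow> real" where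
  "eigencurve a b m k lam = (LEAST t. at_least_eigenvalues a b m lam k t)"

(* k linearly independent vectors v 1, ..., v k on whose span the quadratic form q is positive
   definite. Requiring only q (v i) > 0 would not suffice below: with a = m the inner product
   of R^2 and b = diag(1, -1), the quadratic form of b is positive at the independent vectors
   (2, 1) and (2, -1), but the second eigencurve is 1 + \<bar>lam\<bar>. *)
definition independent_positive :: "('v::real_vector \<Rightarrow> real) \<Rightarrow> nat \<Rightarrow> (nat \<Rightarrow> 'v) \<Rightarrow> bool" where
  "independent_positive q k v \<longleftrightarrow>
     inj_on v {1..k} \<and> independent (v ` {1..k}) \<and>
     (\<forall>u\<in>span (v ` {1..k}). u \<noteq> 0 \<longrightarrow> 0 < q u)"

end

theory Submission
  imports Defs
begin

text \<open>The eigencurve is defined by counting eigenvalues, so an upper bound for it requires two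
things: enough eigenvalues below the bound, and a smallest threshold below which \<open>k\<close> of them lie
(the \<open>LEAST\<close> in the definition says nothing unless it is attained). Both come from compactness.

Fix \<open>\<lambda>\<close> and put \<open>c = a - \<lambda> b\<close>. Bounded sequences of a separable Hilbert space have weakly
convergent subsequences (\<open>bounded_imp_weakly_convergent_subseq\<close>), \<open>b\<close> and \<open>m\<close> pass to weak
limits, and \<open>c\<close> is weakly lower semicontinuous because \<open>a\<close> is convex. The compactness of \<open>b\<close> and
\<open>m\<close> also gives a Garding inequality \<open>\<kappa> \<parallel>u\<parallel>\<^sup>2 \<le> c(u,u) + C m(u,u)\<close>, so a set of vectors with \<open>m(u,u) = 1\<close>
and \<open>c(u,u)\<close> bounded above is norm bounded and stays on \<open>m(u,u) = 1\<close> in the weak limit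
(\<open>normalized_weak_limit\<close>). This has two consequences.

First, the Rayleigh quotient \<open>c(u,u) / m(u,u)\<close> attains its minimum on the \<open>m\<close>-orthogonal
complement of finitely many eigenvectors, and a minimiser is a further eigenvector. If \<open>c \<le> T m\<close>
on a \<open>k\<close>-dimensional space \<open>W\<close>, then \<open>W\<close> contains a nonzero vector orthogonal to any \<open>j < k\<close>
eigenvectors already found, so the next eigenvalue is at most \<open>T\<close>. This is repeated until there are
\<open>k\<close> eigenvectors.

Secondly, only finitely many eigenvalues lie below a given number: normalised eigenvectors for
infinitely many of them would be \<open>m\<close>-orthonormal and have a weakly convergent subsequence, whose
limit \<open>u\<close> would satisfy both \<open>m(u,u) = 1\<close> and \<open>m(u,u) = 0\<close>. Hence the least threshold exists, and
\<open>\<mu>\<^sub>k(\<lambda>) \<le> T\<close> follows (\<open>eigencurve_le_if_rayleigh_le\<close>).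

To conclude, let \<open>W\<close> be the span of the \<open>k\<close> given vectors and \<open>T\<close> any real number. Since \<open>b\<close> is
positive definite on the finite-dimensional \<open>W\<close>, there is \<open>Q\<close> with \<open>a - T m \<le> Q b\<close> on \<open>W\<close>, so
\<open>a - \<lambda> b \<le> T m\<close> on \<open>W\<close> for all \<open>\<lambda> \<ge> Q\<close>, that is, \<open>\<mu>\<^sub>k(\<lambda>) \<le> T\<close>. The behaviour at \<open>-\<infinity>\<close> is
the same statement for \<open>-b\<close> and \<open>-\<lambda>\<close>.\<close>

section \<open>Symmetric bilinear forms\<close>

lemma symmetric_bilinear_simps:
  fixes f :: "'v::real_vector \<Rightarrow> 'v \<Rightarrow> real"
  assumes "symmetric_bilinear f"
  shows "f (x + y) z = f x z + f y z" "f z (x + y) = f z x + f z y"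
    "f (x - y) z = f x z - f y z" "f z (x - y) = f z x - f z y"
    "f (t *\<^sub>R x) z = t * f x z" "f z (t *\<^sub>R x) = t * f z x"
    "f 0 z = 0" "f z 0 = 0"
    "f (sum h A) z = (\<Sum>i\<in>A. f (h i) z)" "f z (sum h A) = (\<Sum>i\<in>A. f z (h i))"
proof -
  have bl: "bilinear f" using assms by (simp add: symmetric_bilinear_def)
  then have lin: "linear (f z)" "linear (\<lambda>x. f x z)" by (auto simp: bilinear_def)
  show "f (sum h A) z = (\<Sum>i\<in>A. f (h i) z)" "f z (sum h A) = (\<Sum>i\<in>A. f z (h i))"
    using linear_sum[OF lin(2)] linear_sum[OF lin(1)] by auto
qed (use assms in \<open>auto simp: symmetric_bilinear_def bilinear_ladd bilinear_radd bilinear_lsub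
      bilinear_rsub bilinear_lmul bilinear_rmul bilinear_lzero bilinear_rzero\<close>)

lemma symmetric_bilinear_commute: "symmetric_bilinear f \<Longrightarrow> f u v = f v u"
  by (simp add: symmetric_bilinear_def)

lemma symmetric_bilinear_along_line:
  fixes f :: "'v::real_vector \<Rightarrow> 'v \<Rightarrow> real"
  assumes "symmetric_bilinear f"
  shows "f (u + t *\<^sub>R v) (u + t *\<^sub>R v) = f u u + 2 * t * f u v + t\<^sup>2 * f v v"
proof -
  have "bilinear f" "f v u = f u v" using assms by (auto simp: symmetric_bilinear_def)
  then show ?thesis
    by (simp add: bilinear_ladd bilinear_radd bilinear_lmul bilinear_rmul algebra_simps
        power2_eq_square)
qed

text \<open>The first-order condition for a minimum at \<open>t = 0\<close>. It yields both the representing vector of a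
functional and the Euler equation of the Rayleigh quotient.\<close>

lemma quadratic_nonneg_imp_linear_coeff_zero:
  fixes p q :: real
  assumes "\<And>t. 0 \<le> 2 * t * p + t\<^sup>2 * q"
  shows "p = 0"
proof (rule ccontr)
  assume "p \<noteq> 0"
  define B where "B = \<bar>q\<bar> + 1"
  have B: "B > 0" "q < B" by (auto simp: B_def)
  \<comment> \<open>For \<open>q > 0\<close> the minimiser is \<open>- p / q\<close>; replacing \<open>q\<close> by the larger \<open>B > 0\<close> covers every sign of \<open>q\<close>.\<close>
  have "0 \<le> 2 * (- p / B) * p + (- p / B)\<^sup>2 * q" by (rule assms)
  also have "\<dots> = p\<^sup>2 / B * (q / B - 2)"
    using B by (simp add: field_simps power2_eq_square)
  also have "\<dots> < 0"
    using B \<open>p \<noteq> 0\<close> by (intro mult_pos_neg) (auto simp: field_simps)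
  finally show False by simp
qed

text \<open>Finiteness is part of the notion because expansions are finite sums. The form may be any
symmetric one: \<open>m\<close> for eigenvectors, \<open>b\<close> in the asymptotic estimate.\<close>

definition orthonormal_for :: "('v::real_vector \<Rightarrow> 'v \<Rightarrow> real) \<Rightarrow> 'v set \<Rightarrow> bool" where
  "orthonormal_for f F \<longleftrightarrow> finite F \<and> (\<forall>x\<in>F. \<forall>y\<in>F. f x y = (if x = y then 1 else 0))"

lemma orthonormal_for_coeff:
  assumes f: "symmetric_bilinear f" and F: "orthonormal_for f F" and "x \<in> F"
  shows "f x (\<Sum>y\<in>F. c y *\<^sub>R y) = c x"
proof -
  have "f x (\<Sum>y\<in>F. c y *\<^sub>R y) = (\<Sum>y\<in>F. c y * f x y)"
    by (simp add: symmetric_bilinear_simps[OF f])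
  also have "\<dots> = (\<Sum>y\<in>F. if x = y then c y else 0)"
    using F \<open>x \<in> F\<close> by (intro sum.cong) (auto simp: orthonormal_for_def)
  also have "\<dots> = c x" using F \<open>x \<in> F\<close> by (simp add: orthonormal_for_def)
  finally show ?thesis .
qed

lemma orthonormal_for_expand:
  assumes f: "symmetric_bilinear f" and F: "orthonormal_for f F" and "w \<in> span F"
  shows "w = (\<Sum>x\<in>F. f x w *\<^sub>R x)"
proof -
  have "finite F" using F by (simp add: orthonormal_for_def)
  then obtain c where c: "w = (\<Sum>x\<in>F. c x *\<^sub>R x)"
    using \<open>w \<in> span F\<close> by (auto simp: span_finite)
  show ?thesis
    using orthonormal_for_coeff[OF f F, of _ c] by (subst (1) c) (simp add: c cong: sum.cong)
qed

lemma orthonormal_for_independent: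
  assumes f: "symmetric_bilinear f" and F: "orthonormal_for f F"
  shows "independent F"
proof (rule independent_if_scalars_zero)
  show "finite F" using F by (simp add: orthonormal_for_def)
  fix c x assume "(\<Sum>x\<in>F. c x *\<^sub>R x) = 0" "x \<in> F"
  then show "c x = 0"
    using orthonormal_for_coeff[OF f F, of x c] by (simp add: symmetric_bilinear_simps[OF f])
qed

lemma orthonormal_for_residual:
  assumes f: "symmetric_bilinear f" and F: "orthonormal_for f F" and "x \<in> F"
  shows "f x (v - (\<Sum>y\<in>F. f y v *\<^sub>R y)) = 0"
  using orthonormal_for_coeff[OF f F \<open>x \<in> F\<close>, of "\<lambda>y. f y v"]
  by (simp only: symmetric_bilinear_simps[OF f])

lemma orthonormal_for_insert:
  assumes f: "symmetric_bilinear f" and F: "orthonormal_for f F"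
    and "f u u = 1" and "\<And>x. x \<in> F \<Longrightarrow> f x u = 0"
  shows "u \<notin> F" and "orthonormal_for f (insert u F)"
proof -
  have "f u x = 0" if "x \<in> F" for x
    using assms(4)[OF that] symmetric_bilinear_commute[OF f, of u x] by simp
  then show "u \<notin> F" "orthonormal_for f (insert u F)"
    using assms by (auto simp: orthonormal_for_def)
qed

text \<open>Definiteness is asked for on the span only, since the form that is used here (\<open>b\<close>) is in general
indefinite on the whole space.\<close>

lemma gram_schmidt_for:
  assumes f: "symmetric_bilinear f" and "finite S"
    and "\<forall>w\<in>span S. w \<noteq> 0 \<longrightarrow> 0 < f w w"
  obtains F where "orthonormal_for f F" "span F = span S"
proof -
  have "\<exists>F. orthonormal_for f F \<and> span F = span S"
    using assms(2,3)
  proof (induction S)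
    case empty
    have "orthonormal_for f {}" by (simp add: orthonormal_for_def)
    then show ?case by blast
  next
    case (insert s S)
    have "span S \<subseteq> span (insert s S)" by (intro span_mono) auto
    with insert obtain F where F: "orthonormal_for f F" "span F = span S" by blast
    define p where "p = (\<Sum>y\<in>F. f y s *\<^sub>R y)"
    define r where "r = s - p"
    have p: "p \<in> span F" unfolding p_def by (intro span_sum span_scale span_base)
    have eq: "span (insert s F) = span (insert s S)"
      using F(2) by (simp add: span_insert)
    show ?case
    proof (cases "r = 0")
      case True
      then have "s \<in> span F" using p by (simp add: r_def)
      then show ?thesis using F eq by (metis span_redundant)
    next
      case False
      have "s \<in> span (insert s S)" "p \<in> span (insert s S)"
        using p F(2) \<open>span S \<subseteq> _\<close> by (auto intro: span_base)
      then have "r \<in> span (insert s S)" unfolding r_def by (rule span_diff)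
      then have pos: "f r r > 0" using insert.prems False by blast
      define u where "u = (1 / sqrt (f r r)) *\<^sub>R r"
      have u: "f u u = 1" using pos by (simp add: u_def symmetric_bilinear_simps[OF f])
      have orth: "f x u = 0" if "x \<in> F" for x
        using orthonormal_for_residual[OF f F(1) that, of s]
        by (simp add: u_def r_def p_def symmetric_bilinear_simps(6)[OF f])
      have "span (insert u F) = span (insert s F)"
      proof (rule subset_antisym; rule span_minimal)
        have "r \<in> span (insert s F)"
          using p span_mono[of F "insert s F"] unfolding r_def
          by (intro span_diff) (auto intro: span_base)
        then show "insert u F \<subseteq> span (insert s F)"
          by (auto simp: u_def intro: span_scale span_base)
        have "sqrt (f r r) *\<^sub>R u \<in> span (insert u F)" by (intro span_scale span_base) simp
        moreover have "sqrt (f r r) *\<^sub>R u = r" using pos by (simp add: u_def)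
        moreover have "p \<in> span (insert u F)" using p span_mono[of F "insert u F"] by auto
        ultimately have "r + p \<in> span (insert u F)" using span_add by metis
        then show "insert s F \<subseteq> span (insert u F)"
          by (auto simp: r_def intro: span_base)
      qed auto
      moreover have "orthonormal_for f (insert u F)"
        by (rule orthonormal_for_insert(2)[OF f F(1) u orth])
      ultimately show ?thesis using eq by blast
    qed
  qed
  then show thesis using that by blast
qed

lemma orthonormal_for_sum_squares:
  assumes f: "symmetric_bilinear f" and F: "orthonormal_for f F" and "w \<in> span F"
  shows "f w w = (\<Sum>x\<in>F. (f x w)\<^sup>2)"
proof -
  have "f w w = f (\<Sum>x\<in>F. f x w *\<^sub>R x) w" using orthonormal_for_expand[OF assms] by simp
  also have "\<dots> = (\<Sum>x\<in>F. (f x w)\<^sup>2)"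
    by (simp add: symmetric_bilinear_simps[OF f] power2_eq_square)
  finally show ?thesis .
qed

text \<open>In a basis of the span that is orthonormal for \<open>f\<close>, the form \<open>f\<close> becomes the sum of the squares of
the coordinates, and each monomial of \<open>q\<close> is bounded by that sum. This replaces a compactness
argument on the unit sphere of the span.\<close>

lemma form_dominated_on_finite_span:
  assumes q: "symmetric_bilinear q" and f: "symmetric_bilinear f" and "finite S"
    and pos: "\<forall>w\<in>span S. w \<noteq> 0 \<longrightarrow> 0 < f w w"
  obtains Q where "\<And>w. w \<in> span S \<Longrightarrow> q w w \<le> Q * f w w"
proof -
  obtain F where F: "orthonormal_for f F" "span F = span S"
    using gram_schmidt_for[OF f \<open>finite S\<close> pos] by blast
  have fin: "finite F" using F by (simp add: orthonormal_for_def)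
  define Q where "Q = (\<Sum>x\<in>F. \<Sum>y\<in>F. \<bar>q x y\<bar>)"
  have "q w w \<le> Q * f w w" if "w \<in> span S" for w
  proof -
    have w: "w \<in> span F" using that F by simp
    let ?c = "\<lambda>x. f x w"
    have sq: "f w w = (\<Sum>x\<in>F. (?c x)\<^sup>2)" by (rule orthonormal_for_sum_squares[OF f F(1) w])
    have *: "?c x * ?c y * q x y \<le> f w w * \<bar>q x y\<bar>" if "x \<in> F" "y \<in> F" for x y
    proof -
      have "(?c x)\<^sup>2 \<le> f w w" "(?c y)\<^sup>2 \<le> f w w"
        unfolding sq using fin that by (auto intro: member_le_sum)
      moreover have "2 * \<bar>?c x * ?c y\<bar> \<le> (?c x)\<^sup>2 + (?c y)\<^sup>2"
        using sum_squares_bound[of "\<bar>?c x\<bar>" "\<bar>?c y\<bar>"] by (simp add: abs_mult)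
      ultimately have "\<bar>?c x * ?c y\<bar> \<le> f w w" by linarith
      then have "\<bar>?c x * ?c y\<bar> * \<bar>q x y\<bar> \<le> f w w * \<bar>q x y\<bar>" by (rule mult_right_mono) simp
      then show ?thesis using abs_ge_self[of "?c x * ?c y * q x y"] by (simp add: abs_mult)
    qed
    have "q w w = q (\<Sum>x\<in>F. ?c x *\<^sub>R x) (\<Sum>x\<in>F. ?c x *\<^sub>R x)"
      using orthonormal_for_expand[OF f F(1) w] by simp
    also have "\<dots> = (\<Sum>x\<in>F. \<Sum>y\<in>F. ?c x * ?c y * q x y)"
      by (simp only: symmetric_bilinear_simps(5,9)[OF q],
        simp only: symmetric_bilinear_simps(6,10)[OF q] sum_distrib_left mult.assoc)
    also have "\<dots> \<le> (\<Sum>x\<in>F. \<Sum>y\<in>F. f w w * \<bar>q x y\<bar>)"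
      by (intro sum_mono *)
    also have "\<dots> = Q * f w w" by (simp add: Q_def sum_distrib_left sum_distrib_right mult.commute)
    finally show ?thesis .
  qed
  then show thesis by (rule that)
qed

text \<open>Dimension count: if there were no such vector, the orthogonal projection onto \<open>span F\<close> would be
injective on \<open>span S\<close>.\<close>

lemma span_contains_orthogonal_vector:
  assumes f: "symmetric_bilinear f" and F: "orthonormal_for f F" and S: "independent S"
    and card: "card F < card S"
  obtains w where "w \<in> span S" "w \<noteq> 0" "\<And>x. x \<in> F \<Longrightarrow> f x w = 0"
proof -
  define L where "L w = (\<Sum>x\<in>F. f x w *\<^sub>R x)" for w
  have L: "linear L"
    unfolding L_def
    by (rule linearI) (auto simp: symmetric_bilinear_simps(2,6)[OF f] scaleR_add_left sum.distrib
        scaleR_sum_right)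
  have "\<not> inj_on L (span S)"
  proof
    assume inj: "inj_on L (span S)"
    have "independent (L ` S)" by (rule linear_independent_injective_image[OF L S inj])
    moreover have "L ` S \<subseteq> span F"
      by (auto simp: L_def intro: span_sum span_scale span_base)
    ultimately have "card (L ` S) \<le> card F"
      using F independent_span_bound[of F "L ` S"] by (auto simp: orthonormal_for_def)
    moreover have "card (L ` S) = card S"
      using inj inj_on_subset[OF _ span_superset] by (intro card_image)
    ultimately show False using card by simp
  qed
  then obtain w where w: "w \<in> span S" "w \<noteq> 0" "L w = 0"
    using linear_injective_on_subspace_0[OF L, of "span S"] by auto
  have "f x w = 0" if "x \<in> F" for x
    using orthonormal_for_coeff[OF f F that, of "\<lambda>x. f x w"] w(3)
    by (simp add: L_def symmetric_bilinear_simps(8)[OF f])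
  with w show thesis by (intro that)
qed

section \<open>Weak sequential compactness in a separable Hilbert space\<close>

lemma symmetric_bilinear_inner: "symmetric_bilinear (inner :: 'v::real_inner \<Rightarrow> _)"
  by (simp add: symmetric_bilinear_def bilinear_def linear_iff inner_commute inner_add_right)

text \<open>The representing vector minimises \<open>g x = \<parallel>x\<parallel>\<^sup>2 - 2 \<phi> x\<close>: by the parallelogram law minimising sequences
of \<open>g\<close> are Cauchy, and the first-order condition at the limit \<open>y\<close> reads \<open>\<phi> x = y \<bullet> x\<close>.\<close>

theorem riesz_representation:
  fixes \<phi> :: "'v::{real_inner, complete_space} \<Rightarrow> real"
  assumes "bounded_linear \<phi>"
  obtains y where "\<And>x. \<phi> x = inner y x"
proof -
  interpret \<phi>: bounded_linear \<phi> by fact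
  define g where "g x = inner x x - 2 * \<phi> x" for x
  obtain K where K: "\<And>x. norm (\<phi> x) \<le> norm x * K" using \<phi>.bounded by blast
  have bdd: "- K\<^sup>2 \<le> g x" for x
  proof -
    have "0 \<le> (norm x - K)\<^sup>2" by simp
    moreover have "\<phi> x \<le> norm x * K" using K[of x] by simp
    ultimately show ?thesis
      by (simp add: g_def power2_diff power2_norm_eq_inner)
  qed
  define d where "d = (INF x. g x)"
  have bb: "bdd_below (range g)" using bdd by (auto intro!: bdd_belowI)
  have d: "d \<le> g x" for x unfolding d_def by (rule cINF_lower[OF bb]) simp
  have "\<exists>x. g x < d + 1 / real (Suc n)" for n
    using cINF_less_iff[OF _ bb, of "d + 1 / real (Suc n)"] by (simp add: d_def)
  then obtain X where X: "\<And>n. g (X n) < d + 1 / real (Suc n)" by metis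
  \<comment> \<open>Parallelogram law; the linear parts of \<open>g\<close> cancel.\<close>
  have par: "inner (x - y) (x - y) = 2 * g x + 2 * g y - 4 * g ((1/2) *\<^sub>R (x + y))" for x y
    by (simp add: g_def inner_add_left inner_add_right inner_diff_left inner_diff_right
        \<phi>.add \<phi>.scaleR inner_commute algebra_simps)
  have "Cauchy X"
    unfolding Cauchy_def
  proof (intro allI impI)
    fix e :: real assume "e > 0"
    then obtain N where N: "1 / real (Suc N) < e\<^sup>2 / 4"
      using nat_approx_posE[of "e\<^sup>2/4"] by auto
    have "dist (X i) (X j) < e" if "i \<ge> N" "j \<ge> N" for i j
    proof -
      have le: "1 / real (Suc i) \<le> 1 / real (Suc N)" "1 / real (Suc j) \<le> 1 / real (Suc N)"
        using that by (auto simp: frac_le)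
      have "(dist (X i) (X j))\<^sup>2 = 2 * g (X i) + 2 * g (X j) - 4 * g ((1/2) *\<^sub>R (X i + X j))"
        using par[of "X i" "X j"] by (simp add: dist_norm power2_norm_eq_inner)
      also have "\<dots> < e\<^sup>2"
        using X[of i] X[of j] d[of "(1/2) *\<^sub>R (X i + X j)"] le N by linarith
      finally show ?thesis using \<open>e > 0\<close> by (simp add: power_less_imp_less_base)
    qed
    then show "\<exists>M. \<forall>m\<ge>M. \<forall>n\<ge>M. dist (X m) (X n) < e" by blast
  qed
  then obtain y where y: "X \<longlonglongrightarrow> y" using Cauchy_convergent convergent_def by blast
  have "(\<lambda>n. g (X n)) \<longlonglongrightarrow> g y"
    unfolding g_def by (intro tendsto_intros y \<phi>.tendsto)
  moreover have "(\<lambda>n. g (X n)) \<longlonglongrightarrow> d"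
  proof (rule tendsto_sandwich[of "\<lambda>_. d" _ _ "\<lambda>n. d + 1 / real (Suc n)"])
    show "(\<lambda>n. d + 1 / real (Suc n)) \<longlonglongrightarrow> d"
      using tendsto_add[OF tendsto_const LIMSEQ_inverse_real_of_nat, of d]
      by (simp add: inverse_eq_divide)
  qed (use d X in \<open>auto intro!: always_eventually less_imp_le\<close>)
  ultimately have gy: "g y = d" by (rule LIMSEQ_unique)
  have "\<phi> x = inner y x" for x
  proof -
    have "inner y x - \<phi> x = 0"
    proof (rule quadratic_nonneg_imp_linear_coeff_zero[of _ "inner x x"])
      fix t
      have "g y \<le> g (y + t *\<^sub>R x)" using d gy by simp
      then show "0 \<le> 2 * t * (inner y x - \<phi> x) + t\<^sup>2 * inner x x"
        by (simp add: g_def symmetric_bilinear_along_line[OF symmetric_bilinear_inner] \<phi>.add \<phi>.scaleR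
            inner_commute[of x y] power2_eq_square algebra_simps)
    qed
    then show ?thesis by simp
  qed
  then show thesis by (rule that)
qed

lemma weakly_converges_iff_inner:
  fixes l :: "'v::{real_inner, complete_space}"
  shows "weakly_converges u l \<longleftrightarrow> (\<forall>y. (\<lambda>j. inner y (u j)) \<longlonglongrightarrow> inner y l)"
proof
  assume "weakly_converges u l"
  then show "\<forall>y. (\<lambda>j. inner y (u j)) \<longlonglongrightarrow> inner y l"
    unfolding weakly_converges_def using bounded_linear_inner_right by blast
next
  assume *: "\<forall>y. (\<lambda>j. inner y (u j)) \<longlonglongrightarrow> inner y l"
  show "weakly_converges u l"
    unfolding weakly_converges_def
  proof (intro allI impI)
    fix \<phi> :: "'v \<Rightarrow> real" assume "bounded_linear \<phi>"
    then obtain y where "\<And>x. \<phi> x = inner y x" by (rule riesz_representation) blast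
    with * show "(\<lambda>j. \<phi> (u j)) \<longlonglongrightarrow> \<phi> l" by simp
  qed
qed

lemma weakly_converges_subseq:
  "weakly_converges u l \<Longrightarrow> strict_mono r \<Longrightarrow> weakly_converges (u \<circ> r) l"
  unfolding weakly_converges_def using LIMSEQ_subseq_LIMSEQ by (fastforce simp: o_def)

lemma weakly_converges_const: "weakly_converges (\<lambda>_. l) l"
  by (simp add: weakly_converges_def)

text \<open>Boundedness of the sequence makes the functionals \<open>y \<mapsto> y \<bullet> u n\<close> equicontinuous, so pointwise
convergence spreads from a dense set to its closure.\<close>

lemma inner_convergent_from_dense:
  fixes u :: "nat \<Rightarrow> 'v::real_inner"
  assumes bd: "\<And>n. norm (u n) \<le> K" and dense: "closure D = UNIV"
    and conv: "\<And>d. d \<in> D \<Longrightarrow> convergent (\<lambda>n. inner d (u n))"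
  shows "convergent (\<lambda>n. inner y (u n))"
proof -
  have K: "0 \<le> K" using bd[of 0] norm_ge_zero order_trans by blast
  have "Cauchy (\<lambda>n. inner y (u n))"
    unfolding Cauchy_def
  proof (intro allI impI)
    fix e :: real assume e: "e > 0"
    define \<delta> where "\<delta> = e / (3 * (K + 1))"
    have "\<delta> > 0" using e K by (simp add: \<delta>_def)
    then obtain d where d: "d \<in> D" "dist d y < \<delta>"
      using dense closure_approachable[of y D] by auto
    have near: "\<bar>inner y (u n) - inner d (u n)\<bar> \<le> e / 3" for n
    proof -
      have "\<bar>inner (y - d) (u n)\<bar> \<le> norm (y - d) * norm (u n)" by (rule Cauchy_Schwarz_ineq2)
      also have "\<dots> \<le> \<delta> * (K + 1)"
        using d bd[of n] K \<open>\<delta> > 0\<close> by (intro mult_mono) (auto simp: dist_norm norm_minus_commute)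
      also have "\<dots> = e / 3" using K by (simp add: \<delta>_def field_simps)
      finally show ?thesis by (simp add: inner_diff_left)
    qed
    have "Cauchy (\<lambda>n. inner d (u n))" using conv[OF d(1)] by (rule convergent_Cauchy)
    from metric_CauchyD[OF this, of "e / 3"]
    obtain M where M: "\<forall>i\<ge>M. \<forall>j\<ge>M. \<bar>inner d (u i) - inner d (u j)\<bar> < e / 3"
      using e by (auto simp: dist_real_def)
    have "dist (inner y (u i)) (inner y (u j)) < e" if "i \<ge> M" "j \<ge> M" for i j
      using near[of i] near[of j] M[rule_format, OF that] unfolding dist_real_def by linarith
    then show "\<exists>M. \<forall>m\<ge>M. \<forall>n\<ge>M. dist (inner y (u m)) (inner y (u n)) < e" by blast
  qed
  then show ?thesis by (simp add: Cauchy_convergent)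
qed

text \<open>The sequences \<open>i \<mapsto> d i \<bullet> u n\<close>, with \<open>d\<close> enumerating a dense set, lie in a product of compact
intervals. Compactness of that product in the metrizable space \<open>nat \<Rightarrow> real\<close> takes the place of a
diagonal argument. The limits along the subsequence form a bounded functional, and its
representing vector is the weak limit.\<close>

theorem bounded_imp_weakly_convergent_subseq:
  fixes u :: "nat \<Rightarrow> 'v::{real_inner, complete_space}"
  assumes sep: "separable_space (euclidean :: 'v topology)" and bd: "\<And>n. norm (u n) \<le> K"
  obtains r l where "strict_mono r" "weakly_converges (u \<circ> r) l"
proof -
  obtain D :: "'v set" where D: "countable D" "closure D = UNIV"
    using sep by (auto simp: separable_space_def)
  then have ne: "D \<noteq> {}" by auto
  define d where "d = from_nat_into D"
  have d: "range d = D" unfolding d_def by (rule range_from_nat_into[OF ne D(1)])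
  define S where "S i = {- (norm (d i) * K) .. norm (d i) * K}" for i
  define x where "x n = (\<lambda>i. inner (d i) (u n))" for n
  have "compactin (product_topology (\<lambda>_. euclidean) UNIV) (PiE UNIV S)"
    unfolding compactin_PiE by (auto simp: S_def)
  then have "seq_compact (PiE UNIV S)"
    unfolding euclidean_product_topology by (simp add: compact_imp_seq_compact)
  moreover have "x n \<in> PiE UNIV S" for n
  proof -
    have "\<bar>inner (d i) (u n)\<bar> \<le> norm (d i) * K" for i
      using Cauchy_Schwarz_ineq2[of "d i" "u n"] bd[of n]
      by (meson mult_left_mono norm_ge_zero order_trans)
    then show ?thesis by (auto simp: x_def S_def abs_le_iff minus_le_iff)
  qed
  ultimately obtain L r where r: "strict_mono (r :: nat \<Rightarrow> nat)" and L: "(x \<circ> r) \<longlonglongrightarrow> L"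
    unfolding seq_compact_def by metis
  have "(\<lambda>n. x (r n) i) \<longlonglongrightarrow> L i" for i
    using continuous_on_tendsto_compose[OF continuous_on_product_coordinates L]
    by (auto simp: o_def)
  then have conv_D: "convergent (\<lambda>n. inner e (u (r n)))" if e: "e \<in> D" for e
  proof -
    obtain i where "e = d i" using e d by blast
    with \<open>\<And>i. (\<lambda>n. x (r n) i) \<longlonglongrightarrow> L i\<close>[of i] show ?thesis by (auto simp: x_def convergent_def)
  qed
  have conv: "convergent (\<lambda>n. inner y ((u \<circ> r) n))" for y
    by (rule inner_convergent_from_dense[of "u \<circ> r" K D]) (simp_all add: bd D(2) conv_D)
  define \<psi> where "\<psi> y = lim (\<lambda>n. inner y ((u \<circ> r) n))" for y
  have \<psi>: "(\<lambda>n. inner y ((u \<circ> r) n)) \<longlonglongrightarrow> \<psi> y" for y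
    using conv by (simp add: \<psi>_def convergent_LIMSEQ_iff)
  have "bounded_linear \<psi>"
  proof (rule bounded_linear_intro)
    fix y z :: 'v and t :: real
    show "\<psi> (y + z) = \<psi> y + \<psi> z"
      using tendsto_add[OF \<psi>[of y] \<psi>[of z]] \<psi>[of "y + z"]
      by (intro LIMSEQ_unique) (auto simp: inner_add_left)
    show "\<psi> (t *\<^sub>R y) = t *\<^sub>R \<psi> y"
      using tendsto_mult_left[OF \<psi>[of y], of t] \<psi>[of "t *\<^sub>R y"]
      by (intro LIMSEQ_unique) auto
    have "norm (inner y ((u \<circ> r) n)) \<le> norm y * K" for n
      using Cauchy_Schwarz_ineq2[of y "u (r n)"] bd[of "r n"]
      by (simp, meson mult_left_mono norm_ge_zero order_trans)
    then show "norm (\<psi> y) \<le> norm y * K"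
      by (intro Lim_norm_ubound[OF _ \<psi>]) auto
  qed
  then obtain l where "\<And>y. \<psi> y = inner l y" by (rule riesz_representation) blast
  then have "weakly_converges (u \<circ> r) l"
    using \<psi> by (simp add: weakly_converges_iff_inner inner_commute)
  with r show thesis by (rule that)
qed

section \<open>The form a - lam b at a fixed parameter\<close>

text \<open>Nonnegativity of \<open>f\<close> at \<open>u + e\<close> and \<open>u - e\<close> bounds \<open>f u e\<close> by the diagonal values of \<open>f\<close>, so a bound on
the diagonal suffices for boundedness of \<open>f u\<close>.\<close>

lemma bounded_linear_dominated_form:
  fixes f :: "'v::real_normed_vector \<Rightarrow> 'v \<Rightarrow> real"
  assumes f: "symmetric_bilinear f" and nonneg: "\<And>u. 0 \<le> f u u"
    and bd: "\<And>u. f u u \<le> K * (norm u)\<^sup>2"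
  shows "bounded_linear (f u)"
proof (rule bounded_linear_intro)
  fix x
  show "norm (f u x) \<le> norm x * ((f u u + K) / 2)"
  proof (cases "x = 0")
    case False
    define e where "e = (1 / norm x) *\<^sub>R x"
    have "norm e = 1" using False by (simp add: e_def)
    have "0 \<le> f u u + 2 * s * f u e + s\<^sup>2 * f e e" for s
      using nonneg[of "u + s *\<^sub>R e"] by (simp only: symmetric_bilinear_along_line[OF f])
    from this[of 1] this[of "-1"] have "2 * \<bar>f u e\<bar> \<le> f u u + f e e" by simp
    also have "\<dots> \<le> f u u + K" using bd[of e] \<open>norm e = 1\<close> by simp
    finally have "norm x * \<bar>f u e\<bar> \<le> norm x * ((f u u + K) / 2)"
      by (intro mult_left_mono) auto
    moreover have "f u x = norm x * f u e"
      using False by (simp add: e_def symmetric_bilinear_simps[OF f])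
    ultimately show ?thesis by (simp add: abs_mult)
  qed (simp add: symmetric_bilinear_simps[OF f])
qed (simp_all add: symmetric_bilinear_simps[OF f])

locale variational_pencil =
  fixes a b m :: "'v::{real_inner, complete_space} \<Rightarrow> 'v \<Rightarrow> real" and lam :: real
  assumes separable: "separable_space (euclidean :: 'v topology)"
    and a: "symmetric_bilinear a" and b: "symmetric_bilinear b" and m: "symmetric_bilinear m"
    and a_coercive: "continuous_coercive a"
    and b_weak: "weakly_continuous_form b" and m_weak: "weakly_continuous_form m"
    and m_pos: "u \<noteq> 0 \<Longrightarrow> 0 < m u u"
begin

definition c :: "'v \<Rightarrow> 'v \<Rightarrow> real" where
  "c u v = a u v - lam * b u v"

lemma c: "symmetric_bilinear c"
  unfolding symmetric_bilinear_def bilinear_def c_def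
  using symmetric_bilinear_commute[OF a] symmetric_bilinear_commute[OF b]
  by (auto intro!: linearI simp: symmetric_bilinear_simps[OF a] symmetric_bilinear_simps[OF b]
      algebra_simps)

lemma mem_eigenspace: "u \<in> eigenspace a b m lam \<mu> \<longleftrightarrow> (\<forall>v. c u v = \<mu> * m u v)"
  by (simp add: eigenspace_def c_def)

lemma m_nonneg: "0 \<le> m u u"
  using m_pos[of u] by (cases "u = 0") (auto simp: symmetric_bilinear_simps[OF m])

lemma form_weak_limit:
  assumes "weakly_continuous_form f" "weakly_converges us u"
  shows "(\<lambda>j. f (us j) (us j)) \<longlonglongrightarrow> f u u" "(\<lambda>j. f v (us j)) \<longlonglongrightarrow> f v u"
  using assms weakly_converges_const[of v] unfolding weakly_continuous_form_def by blast+

text \<open>If this failed with \<open>\<kappa> / 2\<close>, where \<open>\<kappa>\<close> is the coercivity constant of \<open>a\<close>, there would be unit vectors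
\<open>v n\<close> with \<open>c (v n) (v n) + (n + 1) m (v n) (v n) < \<kappa> / 2\<close>. As \<open>b\<close> is bounded along a weakly
convergent subsequence, \<open>m\<close> tends to 0 there, so the weak limit is 0 by positivity of \<open>m\<close>. But then
\<open>b\<close> tends to 0 too, and \<open>a (v n) (v n) \<ge> \<kappa>\<close> gives a contradiction.\<close>

lemma garding_inequality:
  obtains C \<kappa> where "0 < \<kappa>" "\<And>u. \<kappa> * (norm u)\<^sup>2 \<le> c u u + C * m u u"
proof -
  obtain \<kappa> where \<kappa>: "0 < \<kappa>" "\<And>u. \<kappa> * (norm u)\<^sup>2 \<le> a u u"
    using a_coercive by (auto simp: continuous_coercive_def)
  have "\<exists>n. \<forall>u. \<kappa> / 2 * (norm u)\<^sup>2 \<le> c u u + real (Suc n) * m u u"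
  proof (rule ccontr)
    assume "\<not> ?thesis"
    then have "\<forall>n. \<exists>u. c u u + real (Suc n) * m u u < \<kappa> / 2 * (norm u)\<^sup>2"
      by (simp add: not_le)
    then obtain u where u: "\<And>n. c (u n) (u n) + real (Suc n) * m (u n) (u n) < \<kappa> / 2 * (norm (u n))\<^sup>2"
      by metis
    define v where "v n = (1 / norm (u n)) *\<^sub>R u n" for n
    have nz: "u n \<noteq> 0" for n
      using u[of n] by (auto simp: symmetric_bilinear_simps[OF c] symmetric_bilinear_simps[OF m])
    have nv: "norm (v n) = 1" for n using nz by (simp add: v_def)
    have scaled: "c (v n) (v n) + real (Suc n) * m (v n) (v n) < \<kappa> / 2" for n
    proof -
      have "c (v n) (v n) + real (Suc n) * m (v n) (v n)
          = (c (u n) (u n) + real (Suc n) * m (u n) (u n)) / (norm (u n))\<^sup>2"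
        by (simp add: v_def symmetric_bilinear_simps(5,6)[OF c] symmetric_bilinear_simps(5,6)[OF m]
            power2_eq_square add_divide_distrib)
      also have "\<dots> < \<kappa> / 2" using u[of n] nz[of n] by (simp add: pos_divide_less_eq)
      finally show ?thesis .
    qed
    obtain r w where r: "strict_mono r" and w: "weakly_converges (v \<circ> r) w"
      using bounded_imp_weakly_convergent_subseq[OF separable, of v 1] nv by auto
    define \<beta> where "\<beta> = (\<lambda>n. b (v (r n)) (v (r n)))"
    have \<beta>: "\<beta> \<longlonglongrightarrow> b w w"
      using form_weak_limit(1)[OF b_weak w] by (simp add: \<beta>_def o_def)
    have key: "\<kappa> / 2 + real (Suc n) * m (v (r n)) (v (r n)) < lam * \<beta> n" for n
    proof -
      have "real (Suc n) * m (v (r n)) (v (r n)) \<le> real (Suc (r n)) * m (v (r n)) (v (r n))"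
        using seq_suble[OF r, of n] m_nonneg by (intro mult_right_mono) auto
      then show ?thesis
        using scaled[of "r n"] \<kappa>(2)[of "v (r n)"] nv[of "r n"] by (simp add: c_def \<beta>_def)
    qed
    have "(\<lambda>n. m (v (r n)) (v (r n))) \<longlonglongrightarrow> 0"
    proof (rule tendsto_sandwich[of "\<lambda>_. 0" _ _ "\<lambda>n. lam * \<beta> n * inverse (real (Suc n))"])
      have "m (v (r n)) (v (r n)) \<le> lam * \<beta> n * inverse (real (Suc n))" for n
        using key[of n] \<kappa>(1) by (simp add: field_simps)
      then show "\<forall>\<^sub>F n in sequentially. m (v (r n)) (v (r n)) \<le> lam * \<beta> n * inverse (real (Suc n))"
        by simp
      show "(\<lambda>n. lam * \<beta> n * inverse (real (Suc n))) \<longlonglongrightarrow> 0"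
        using tendsto_mult[OF tendsto_mult_left[OF \<beta>, of lam] LIMSEQ_inverse_real_of_nat] by simp
    qed (auto simp: m_nonneg)
    moreover have "(\<lambda>n. m (v (r n)) (v (r n))) \<longlonglongrightarrow> m w w"
      using form_weak_limit(1)[OF m_weak w] by (simp add: o_def)
    ultimately have "m w w = 0" by (rule LIMSEQ_unique[rotated])
    then have "w = 0" using m_pos[of w] by fastforce
    then have "(\<lambda>n. lam * \<beta> n) \<longlonglongrightarrow> 0"
      using tendsto_mult_left[OF \<beta>, of lam] by (simp add: symmetric_bilinear_simps[OF b])
    moreover have "\<kappa> / 2 \<le> lam * \<beta> n" for n
    proof -
      have "0 \<le> real (Suc n) * m (v (r n)) (v (r n))" by (simp add: m_nonneg)
      then show ?thesis using key[of n] by linarith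
    qed
    ultimately have "\<kappa> / 2 \<le> 0" by (intro LIMSEQ_le_const) auto
    then show False using \<kappa>(1) by simp
  qed
  then show thesis using that[of "\<kappa> / 2"] \<kappa>(1) by (metis half_gt_zero)
qed

text \<open>Convexity of the quadratic form of \<open>a\<close> bounds \<open>a (us j) (us j)\<close> from below by its tangent
\<open>2 a u (us j) - a u u\<close>, which is linear in \<open>us j\<close> and hence weakly continuous; \<open>b\<close> is weakly
continuous anyway.\<close>

lemma c_weakly_lsc:
  assumes u: "weakly_converges us u" and R: "(\<lambda>j. c (us j) (us j)) \<longlonglongrightarrow> R"
  shows "c u u \<le> R"
proof -
  obtain \<kappa>1 \<kappa>2 where \<kappa>: "0 < \<kappa>1" "\<And>v. \<kappa>1 * (norm v)\<^sup>2 \<le> a v v" "\<And>v. a v v \<le> \<kappa>2 * (norm v)\<^sup>2"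
    using a_coercive by (auto simp: continuous_coercive_def)
  have a_nonneg: "0 \<le> a v v" for v
    using \<kappa>(1) \<kappa>(2)[of v] by (meson less_imp_le mult_nonneg_nonneg order_trans zero_le_power2)
  have "bounded_linear (a u)"
    by (rule bounded_linear_dominated_form[OF a a_nonneg \<kappa>(3)])
  then have au: "(\<lambda>j. a u (us j)) \<longlonglongrightarrow> a u u"
    using u by (simp add: weakly_converges_def)
  have bu: "(\<lambda>j. b (us j) (us j)) \<longlonglongrightarrow> b u u" by (rule form_weak_limit(1)[OF b_weak u])
  have ineq: "2 * a u (us j) - a u u - lam * b (us j) (us j) \<le> c (us j) (us j)" for j
    using a_nonneg[of "u + (-1) *\<^sub>R us j"] symmetric_bilinear_along_line[OF a, of u "-1" "us j"]
    by (simp add: c_def)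
  have "(\<lambda>j. 2 * a u (us j) - a u u - lam * b (us j) (us j))
      \<longlonglongrightarrow> 2 * a u u - a u u - lam * b u u"
    by (intro tendsto_intros au bu)
  then have "2 * a u u - a u u - lam * b u u \<le> R"
    using R ineq by (intro LIMSEQ_le) auto
  then show ?thesis by (simp add: c_def)
qed

text \<open>The source of both the existence and the discreteness of the eigenvalues: the Garding inequality
bounds the sequence in norm, and weak continuity of \<open>m\<close> keeps the constraint in the limit.\<close>

lemma normalized_weak_limit:
  fixes us :: "nat \<Rightarrow> 'v"
  assumes m1: "\<And>n. m (us n) (us n) = 1" and cR: "\<And>n. c (us n) (us n) \<le> R"
  obtains r u where "strict_mono r" "weakly_converges (us \<circ> r) u" "m u u = 1"
proof -
  obtain C \<kappa> where \<kappa>: "0 < \<kappa>" and garding: "\<And>u. \<kappa> * (norm u)\<^sup>2 \<le> c u u + C * m u u"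
    by (rule garding_inequality) blast
  have "norm (us n) \<le> sqrt ((R + C) / \<kappa>)" for n
    using garding[of "us n"] cR[of n] m1[of n] \<kappa>
    by (intro real_le_rsqrt) (simp add: field_simps)
  then obtain r u where r: "strict_mono r" and u: "weakly_converges (us \<circ> r) u"
    by (rule bounded_imp_weakly_convergent_subseq[OF separable, of us])
  have "m u u = 1"
    using form_weak_limit(1)[OF m_weak u] m1 by (simp add: o_def LIMSEQ_const_iff)
  with r u show thesis by (rule that)
qed

section \<open>Eigenvectors and the eigencurve\<close>

text \<open>The direct method: a minimising sequence normalised by \<open>m\<close> has a weak limit that still satisfies
the constraints, since \<open>m f\<close> is weakly continuous for each \<open>f\<close>, and lower semicontinuity of \<open>c\<close> makes
the limit a minimiser. The inequality is stated without a quotient so that it includes \<open>v = 0\<close>.\<close>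

lemma rayleigh_quotient_minimum:
  assumes w: "w \<noteq> 0" "\<And>f. f \<in> F \<Longrightarrow> m f w = 0"
  obtains u where "m u u = 1" "\<And>f. f \<in> F \<Longrightarrow> m f u = 0"
    "\<And>v. (\<And>f. f \<in> F \<Longrightarrow> m f v = 0) \<Longrightarrow> c u u * m v v \<le> c v v"
proof -
  define E where "E = {v. \<forall>f\<in>F. m f v = 0}"
  define A where "A = (\<lambda>u. c u u) ` {u\<in>E. m u u = 1}"
  have normalize: "(1 / sqrt (m v v)) *\<^sub>R v \<in> {u\<in>E. m u u = 1}" if "v \<in> E" "v \<noteq> 0" for v
    using that m_pos[of v] by (auto simp: E_def symmetric_bilinear_simps[OF m])
  have "A \<noteq> {}" using normalize[of w] w by (auto simp: A_def E_def)
  obtain C \<kappa> where \<kappa>: "0 < \<kappa>" and garding: "\<And>u. \<kappa> * (norm u)\<^sup>2 \<le> c u u + C * m u u"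
    by (rule garding_inequality) blast
  have "- C \<le> c u u" if "m u u = 1" for u
  proof -
    have "0 \<le> \<kappa> * (norm u)\<^sup>2" using \<kappa> by simp
    then show ?thesis using garding[of u] that by simp
  qed
  then have bdd: "bdd_below A" by (auto simp: A_def intro!: bdd_belowI)
  define R where "R = Inf A"
  have "\<exists>u. u \<in> E \<and> m u u = 1 \<and> c u u < R + 1 / real (Suc n)" for n
    using cInf_less_iff[OF \<open>A \<noteq> {}\<close> bdd, of "R + 1 / real (Suc n)"] by (auto simp: R_def A_def)
  then obtain us where us: "\<And>n. us n \<in> E" "\<And>n. m (us n) (us n) = 1"
    "\<And>n. c (us n) (us n) < R + 1 / real (Suc n)" by metis
  have lower: "R \<le> c v v" if "v \<in> E" "m v v = 1" for v
    unfolding R_def using that by (intro cInf_lower bdd) (auto simp: A_def)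
  have us_le: "c (us n) (us n) \<le> R + 1" for n
  proof -
    have "1 / real (Suc n) \<le> 1" by simp
    then show ?thesis using us(3)[of n] by linarith
  qed
  obtain r u where r: "strict_mono r" and u: "weakly_converges (us \<circ> r) u" and mu: "m u u = 1"
    by (rule normalized_weak_limit[OF us(2) us_le])
  have "(\<lambda>n. c (us n) (us n)) \<longlonglongrightarrow> R"
  proof (rule tendsto_sandwich[of "\<lambda>_. R" _ _ "\<lambda>n. R + 1 / real (Suc n)"])
    show "(\<lambda>n. R + 1 / real (Suc n)) \<longlonglongrightarrow> R"
      using tendsto_add[OF tendsto_const LIMSEQ_inverse_real_of_nat, of R]
      by (simp add: inverse_eq_divide)
  qed (use us lower in \<open>auto intro!: always_eventually less_imp_le\<close>)
  from LIMSEQ_subseq_LIMSEQ[OF this r] have "c u u \<le> R"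
    using c_weakly_lsc[OF u] by (simp add: o_def)
  have uE: "m f u = 0" if "f \<in> F" for f
    using form_weak_limit(2)[OF m_weak u, of f] us(1) that by (simp add: E_def LIMSEQ_const_iff)
  have "c u u * m v v \<le> c v v" if v: "\<And>f. f \<in> F \<Longrightarrow> m f v = 0" for v
  proof (cases "v = 0")
    case False
    then have pos: "0 < m v v" by (rule m_pos)
    have "v \<in> E" using v by (simp add: E_def)
    from normalize[OF this False] have "R \<le> c ((1 / sqrt (m v v)) *\<^sub>R v) ((1 / sqrt (m v v)) *\<^sub>R v)"
      by (intro lower) auto
    also have "\<dots> = c v v / m v v" using pos by (simp add: symmetric_bilinear_simps[OF c])
    finally have "R * m v v \<le> c v v" using pos by (simp add: field_simps)
    moreover have "c u u * m v v \<le> R * m v v" using \<open>c u u \<le> R\<close> pos by simp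
    ultimately show ?thesis by linarith
  qed (simp add: symmetric_bilinear_simps[OF m] symmetric_bilinear_simps[OF c])
  with mu uE show thesis by (rule that)
qed

text \<open>A minimiser \<open>u\<close> of the Rayleigh quotient satisfies the eigenvalue equation against every vector
orthogonal to \<open>F\<close>. Against \<open>f\<close> in \<open>F\<close> both sides vanish, because \<open>c u f\<close> is a multiple of
\<open>m f u = 0\<close>. The comparison with \<open>w\<close> bounds the new eigenvalue.\<close>

lemma next_eigenvector:
  assumes F: "orthonormal_for m F" and eig: "\<And>f. f \<in> F \<Longrightarrow> \<exists>\<mu>. f \<in> eigenspace a b m lam \<mu>"
    and w: "w \<noteq> 0" "\<And>f. f \<in> F \<Longrightarrow> m f w = 0"
  obtains u \<mu> where "u \<in> eigenspace a b m lam \<mu>" "m u u = 1" "\<And>f. f \<in> F \<Longrightarrow> m f u = 0"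
    "\<mu> * m w w \<le> c w w"
proof -
  obtain u where mu: "m u u = 1" and orth: "\<And>f. f \<in> F \<Longrightarrow> m f u = 0"
    and min: "\<And>v. (\<And>f. f \<in> F \<Longrightarrow> m f v = 0) \<Longrightarrow> c u u * m v v \<le> c v v"
    using rayleigh_quotient_minimum[of w F] w by blast
  have euler: "c u v = c u u * m u v" if v: "\<And>f. f \<in> F \<Longrightarrow> m f v = 0" for v
  proof -
    have "c u v - c u u * m u v = 0"
    proof (rule quadratic_nonneg_imp_linear_coeff_zero[of _ "c v v - c u u * m v v"])
      fix t
      have "c u u * m (u + t *\<^sub>R v) (u + t *\<^sub>R v) \<le> c (u + t *\<^sub>R v) (u + t *\<^sub>R v)"
        using orth v by (intro min) (simp add: symmetric_bilinear_simps[OF m])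
      then show "0 \<le> 2 * t * (c u v - c u u * m u v) + t\<^sup>2 * (c v v - c u u * m v v)"
        by (simp add: symmetric_bilinear_along_line[OF c] symmetric_bilinear_along_line[OF m] mu algebra_simps)
    qed
    then show ?thesis by simp
  qed
  have cross: "c u f = 0" "m u f = 0" if f: "f \<in> F" for f
  proof -
    obtain \<mu> where "\<And>v. c f v = \<mu> * m f v" using eig[OF f] by (auto simp: mem_eigenspace)
    then show "c u f = 0" using orth[OF f] symmetric_bilinear_commute[OF c, of u f] by simp
    show "m u f = 0" using orth[OF f] symmetric_bilinear_commute[OF m, of u f] by simp
  qed
  have "c u v = c u u * m u v" for v
  proof -
    \<comment> \<open>Split \<open>v\<close> into its \<open>m\<close>-projection \<open>p\<close> onto \<open>span F\<close> and a part orthogonal to \<open>F\<close>.\<close>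
    define p where "p = (\<Sum>f\<in>F. m f v *\<^sub>R f)"
    have "c u (v - p) = c u u * m u (v - p)"
      unfolding p_def by (intro euler orthonormal_for_residual[OF m F])
    moreover have "c u p = 0" "m u p = 0"
      by (simp_all add: p_def symmetric_bilinear_simps(6,10)[OF c] symmetric_bilinear_simps(6,10)[OF m] cross)
    ultimately show ?thesis
      by (simp add: symmetric_bilinear_simps(4)[OF c] symmetric_bilinear_simps(4)[OF m])
  qed
  then have "u \<in> eigenspace a b m lam (c u u)" unfolding mem_eigenspace by blast
  with mu orth min[OF w(2)] show thesis by (intro that)
qed

text \<open>As long as fewer than \<open>card S\<close> eigenvectors have been found, \<open>span S\<close> contains an admissible
competitor for the next minimisation, and its Rayleigh quotient is at most \<open>T\<close>.\<close>

lemma orthonormal_eigenvectors_below: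
  assumes S: "independent S" and bound: "\<And>w. w \<in> span S \<Longrightarrow> c w w \<le> T * m w w"
    and "j \<le> card S"
  shows "\<exists>F. orthonormal_for m F \<and> card F = j \<and> (\<forall>f\<in>F. \<exists>\<mu>\<le>T. f \<in> eigenspace a b m lam \<mu>)"
  using \<open>j \<le> card S\<close>
proof (induction j)
  case 0
  have "orthonormal_for m {}" by (simp add: orthonormal_for_def)
  then show ?case by (intro exI[of _ "{}"]) simp
next
  case (Suc j)
  then obtain F where F: "orthonormal_for m F" "card F = j"
    and eig: "\<And>f. f \<in> F \<Longrightarrow> \<exists>\<mu>\<le>T. f \<in> eigenspace a b m lam \<mu>" by auto
  have "card F < card S" using F(2) Suc.prems by simp
  then obtain w where w: "w \<in> span S" "w \<noteq> 0" "\<And>f. f \<in> F \<Longrightarrow> m f w = 0"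
    using span_contains_orthogonal_vector[OF m F(1) S] by blast
  have eig': "\<exists>\<mu>. f \<in> eigenspace a b m lam \<mu>" if "f \<in> F" for f
    using eig[OF that] by blast
  obtain u \<mu> where u: "u \<in> eigenspace a b m lam \<mu>" "m u u = 1" "\<And>f. f \<in> F \<Longrightarrow> m f u = 0"
    and le: "\<mu> * m w w \<le> c w w"
    using next_eigenvector[OF F(1) eig' w(2,3)] by blast
  have "\<mu> * m w w \<le> T * m w w" using le bound[OF w(1)] by linarith
  then have "\<mu> \<le> T" using m_pos[OF w(2)] by simp
  moreover have "u \<notin> F" "orthonormal_for m (insert u F)"
    using orthonormal_for_insert[OF m F(1) u(2,3)] by blast+
  moreover have "finite F" using F(1) by (simp add: orthonormal_for_def)
  ultimately show ?case
    using F(2) u(1) eig by (intro exI[of _ "insert u F"]) auto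
qed

text \<open>Eigenvectors for distinct eigenvalues are \<open>m\<close>-orthogonal, so pairing a weakly convergent sequence of
normalised ones with its own shift by one index gives \<open>m u u = 0\<close> for the limit \<open>u\<close>, which
contradicts \<open>m u u = 1\<close>.\<close>

lemma finite_eigenvalues_below:
  "finite {\<mu>. \<mu> \<le> T \<and> (\<exists>u\<in>eigenspace a b m lam \<mu>. u \<noteq> 0)}" (is "finite ?\<Lambda>")
proof (rule ccontr)
  assume "infinite ?\<Lambda>"
  from infinite_countable_subset[OF this]
  obtain \<mu> :: "nat \<Rightarrow> real" where \<mu>: "inj \<mu>" "range \<mu> \<subseteq> ?\<Lambda>"
    by (elim exE conjE)
  have "\<exists>u. u \<in> eigenspace a b m lam (\<mu> n) \<and> m u u = 1" for n
  proof -
    obtain u where u: "u \<in> eigenspace a b m lam (\<mu> n)" "u \<noteq> 0" using \<mu>(2) by auto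
    then show ?thesis
      using m_pos[of u] by (intro exI[of _ "(1 / sqrt (m u u)) *\<^sub>R u"])
        (auto simp: mem_eigenspace symmetric_bilinear_simps[OF c] symmetric_bilinear_simps[OF m])
  qed
  then obtain us where eig: "\<And>n. us n \<in> eigenspace a b m lam (\<mu> n)" and m1: "\<And>n. m (us n) (us n) = 1"
    by metis
  have us_le: "c (us n) (us n) \<le> T" for n
    using eig[of n] m1[of n] \<mu>(2) by (auto simp: mem_eigenspace)
  obtain r u where r: "strict_mono r" and u: "weakly_converges (us \<circ> r) u" and mu: "m u u = 1"
    by (rule normalized_weak_limit[OF m1 us_le])
  have "strict_mono Suc" by (simp add: strict_mono_def)
  then have "weakly_converges ((us \<circ> r) \<circ> Suc) u" by (rule weakly_converges_subseq[OF u])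
  then have "(\<lambda>n. m ((us \<circ> r) n) (((us \<circ> r) \<circ> Suc) n)) \<longlonglongrightarrow> m u u"
    using m_weak u unfolding weakly_continuous_form_def by blast
  moreover have "m (us i) (us j) = 0" if "i \<noteq> j" for i j
  proof -
    have "\<mu> i * m (us i) (us j) = \<mu> j * m (us i) (us j)"
      using eig[of i] eig[of j] symmetric_bilinear_commute[OF c, of "us i" "us j"]
        symmetric_bilinear_commute[OF m, of "us i" "us j"] by (simp add: mem_eigenspace)
    moreover have "\<mu> i \<noteq> \<mu> j" using \<mu>(1) that by (simp add: inj_eq)
    ultimately show ?thesis by simp
  qed
  moreover have "r n \<noteq> r (Suc n)" for n using r by (simp add: strict_mono_eq)
  ultimately show False using mu by (simp add: LIMSEQ_const_iff)
qed

lemma at_least_eigenvalues_if_orthonormal: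
  assumes F: "orthonormal_for m F" and eig: "\<And>f. f \<in> F \<Longrightarrow> \<exists>\<mu>\<le>T. f \<in> eigenspace a b m lam \<mu>"
  shows "at_least_eigenvalues a b m lam (card F) T"
proof -
  have fin: "finite F" using F by (simp add: orthonormal_for_def)
  obtain \<mu> where \<mu>: "\<And>f. f \<in> F \<Longrightarrow> \<mu> f \<le> T \<and> f \<in> eigenspace a b m lam (\<mu> f)"
    using eig by metis
  define B where "B t = {f \<in> F. \<mu> f = t}" for t
  have "card F = (\<Sum>t\<in>\<mu> ` F. card (B t))"
    using sum.image_gen[OF fin, of "\<lambda>_. 1::nat" \<mu>] by (simp add: B_def)
  moreover have "independent (B t)" for t
    using orthonormal_for_independent[OF m F] by (rule independent_mono) (auto simp: B_def)
  moreover have "B t \<subseteq> eigenspace a b m lam t" for t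
    using \<mu> by (auto simp: B_def)
  moreover have "finite (B t)" for t
    using fin by (simp add: B_def)
  moreover have "\<mu> ` F \<subseteq> {..T}" using \<mu> by auto
  ultimately show ?thesis
    unfolding at_least_eigenvalues_def using fin
    by (intro exI[of _ "\<mu> ` F"] exI[of _ B]) simp
qed

text \<open>Lowering the threshold to the largest eigenvalue that is actually counted loses nothing. So
thresholds may be compared through eigenvalues only, of which there are finitely many.\<close>

lemma at_least_eigenvalues_attained:
  assumes "at_least_eigenvalues a b m lam k t" and "1 \<le> k"
  obtains \<mu> where "\<mu> \<le> t" "\<exists>u\<in>eigenspace a b m lam \<mu>. u \<noteq> 0" "at_least_eigenvalues a b m lam k \<mu>"
proof -
  obtain F B where F: "finite F" "F \<subseteq> {..t}" "k \<le> (\<Sum>\<mu>\<in>F. card (B \<mu>))"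
    and B: "\<And>\<mu>. \<mu> \<in> F \<Longrightarrow> finite (B \<mu>) \<and> independent (B \<mu>) \<and> B \<mu> \<subseteq> eigenspace a b m lam \<mu>"
    using assms(1) unfolding at_least_eigenvalues_def by blast
  \<comment> \<open>The finite set in the definition may contain numbers with an empty set of eigenvectors; drop them.\<close>
  define F' where "F' = {\<mu> \<in> F. B \<mu> \<noteq> {}}"
  have fin: "finite F'" using F(1) by (simp add: F'_def)
  have "(\<Sum>\<mu>\<in>F. card (B \<mu>)) = (\<Sum>\<mu>\<in>F'. card (B \<mu>))"
    using F(1) by (intro sum.mono_neutral_right) (auto simp: F'_def)
  then have k: "k \<le> (\<Sum>\<mu>\<in>F'. card (B \<mu>))" using F(3) by simp
  then have ne: "F' \<noteq> {}" using \<open>1 \<le> k\<close> by auto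
  have M: "Max F' \<in> F'" by (rule Max_in[OF fin ne])
  then obtain u where "u \<in> B (Max F')" by (auto simp: F'_def)
  then have "u \<in> eigenspace a b m lam (Max F')" "u \<noteq> 0"
    using B[of "Max F'"] M dependent_zero by (auto simp: F'_def)
  moreover have "at_least_eigenvalues a b m lam k (Max F')"
  proof -
    have "F' \<subseteq> {..Max F'}" using Max_ge[OF fin] by auto
    moreover have "\<forall>\<mu>\<in>F'. finite (B \<mu>) \<and> independent (B \<mu>) \<and> B \<mu> \<subseteq> eigenspace a b m lam \<mu>"
      using B by (simp add: F'_def)
    ultimately show ?thesis
      unfolding at_least_eigenvalues_def using fin k by blast
  qed
  moreover have "Max F' \<le> t" using M F(2) by (auto simp: F'_def)
  ultimately show thesis using that by blast
qed

text \<open>Thresholds need not be eigenvalues, but every threshold lies above one that is. Those up to \<open>t\<close>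
are finite in number, so they have a minimum, and this is the least threshold.\<close>

lemma eigencurve_le:
  assumes t: "at_least_eigenvalues a b m lam k t" and k: "1 \<le> k"
  shows "eigencurve a b m k lam \<le> t"
proof -
  define \<Lambda> where "\<Lambda> = {\<mu>. \<mu> \<le> t \<and> (\<exists>u\<in>eigenspace a b m lam \<mu>. u \<noteq> 0)
    \<and> at_least_eigenvalues a b m lam k \<mu>}"
  have fin: "finite \<Lambda>" by (rule finite_subset[OF _ finite_eigenvalues_below[of t]]) (auto simp: \<Lambda>_def)
  have ne: "\<Lambda> \<noteq> {}"
    by (rule at_least_eigenvalues_attained[OF t k]) (auto simp: \<Lambda>_def)
  have M: "Min \<Lambda> \<in> \<Lambda>" by (rule Min_in[OF fin ne])
  have "eigencurve a b m k lam = Min \<Lambda>"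
    unfolding eigencurve_def
  proof (rule Least_equality)
    show "at_least_eigenvalues a b m lam k (Min \<Lambda>)" using M by (simp add: \<Lambda>_def)
    fix s assume "at_least_eigenvalues a b m lam k s"
    then obtain \<mu> where \<mu>: "\<mu> \<le> s" "\<exists>u\<in>eigenspace a b m lam \<mu>. u \<noteq> 0"
      "at_least_eigenvalues a b m lam k \<mu>" by (rule at_least_eigenvalues_attained[OF _ k])
    show "Min \<Lambda> \<le> s"
    proof (cases "s \<le> t")
      case True
      then have "Min \<Lambda> \<le> \<mu>" using \<mu> by (intro Min_le[OF fin]) (simp add: \<Lambda>_def)
      then show ?thesis using \<mu>(1) by simp
    qed (use M in \<open>auto simp: \<Lambda>_def\<close>)
  qed
  then show ?thesis using M by (simp add: \<Lambda>_def)
qed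

theorem eigencurve_le_if_rayleigh_le:
  assumes S: "independent S" and k: "1 \<le> card S"
    and bound: "\<And>w. w \<in> span S \<Longrightarrow> a w w - lam * b w w \<le> T * m w w"
  shows "eigencurve a b m (card S) lam \<le> T"
proof -
  obtain F where "orthonormal_for m F" "card F = card S"
    "\<forall>f\<in>F. \<exists>\<mu>\<le>T. f \<in> eigenspace a b m lam \<mu>"
    using orthonormal_eigenvectors_below[OF S, of T "card S"] bound by (auto simp: c_def)
  then have "at_least_eigenvalues a b m lam (card S) T"
    using at_least_eigenvalues_if_orthonormal[of F T] by auto
  then show ?thesis using k by (rule eigencurve_le)
qed

end

section \<open>Divergence of the eigencurves\<close>

lemma eigencurve_tendsto_minus_infinity:
  fixes a b m :: "'v::{real_inner, complete_space} \<Rightarrow> 'v \<Rightarrow> real"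
  assumes "separable_space (euclidean :: 'v topology)"
    and a: "symmetric_bilinear a" and b: "symmetric_bilinear b" and m: "symmetric_bilinear m"
    and "continuous_coercive a" and "weakly_continuous_form b" and "weakly_continuous_form m"
    and "\<forall>u. u \<noteq> 0 \<longrightarrow> m u u > 0" and k: "1 \<le> k"
    and v: "independent_positive (\<lambda>u. b u u) k v"
  shows "filterlim (eigencurve a b m k) at_bot at_top"
proof -
  define S where "S = v ` {1..k}"
  have S: "independent S" "finite S" "card S = k" "\<forall>w\<in>span S. w \<noteq> 0 \<longrightarrow> 0 < b w w"
    using v by (auto simp: S_def independent_positive_def card_image)
  have b_nonneg: "0 \<le> b w w" if "w \<in> span S" for w
    using S(4) that by (cases "w = 0") (auto simp: symmetric_bilinear_simps[OF b])
  have "\<forall>\<^sub>F lam in at_top. eigencurve a b m k lam \<le> T" for T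
  proof -
    have q: "symmetric_bilinear (\<lambda>u w. a u w - T * m u w)"
      unfolding symmetric_bilinear_def bilinear_def
      using symmetric_bilinear_commute[OF a] symmetric_bilinear_commute[OF m]
      by (auto intro!: linearI simp: symmetric_bilinear_simps[OF a] symmetric_bilinear_simps[OF m]
          algebra_simps)
    obtain Q where Q: "\<And>w. w \<in> span S \<Longrightarrow> a w w - T * m w w \<le> Q * b w w"
      by (rule form_dominated_on_finite_span[OF q b S(2,4)]) blast
    have "eigencurve a b m k lam \<le> T" if "Q \<le> lam" for lam
    proof -
      interpret variational_pencil a b m lam
        using assms by unfold_locales auto
      have "a w w - lam * b w w \<le> T * m w w" if "w \<in> span S" for w
        using Q[OF that] mult_right_mono[OF \<open>Q \<le> lam\<close> b_nonneg[OF that]] by linarith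
      then show ?thesis using eigencurve_le_if_rayleigh_le[OF S(1), of T] S(3) k by simp
    qed
    then show ?thesis using eventually_at_top_linorder by blast
  qed
  then show ?thesis by (simp add: filterlim_at_bot)
qed

lemma eigencurve_reflect:
  "eigencurve a (\<lambda>u v. - b u v) m k (- lam) = eigencurve a b m k lam"
  by (simp add: eigencurve_def at_least_eigenvalues_def eigenspace_def)

theorem lemma8p2:
  fixes a b m :: "'v::{real_inner, complete_space} \<Rightarrow> 'v \<Rightarrow> real"
    and k :: nat
  assumes "separable_space (euclidean :: 'v topology)"
    and "symmetric_bilinear a" and "symmetric_bilinear b" and "symmetric_bilinear m"
    and "continuous_coercive a"
    and "weakly_continuous_form b"
    and "weakly_continuous_form m"
    and "\<forall>u. u \<noteq> 0 \<longrightarrow> m u u > 0"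
    and "1 \<le> k"
  shows "(\<forall>v. independent_positive (\<lambda>u. b u u) k v \<longrightarrow>
            filterlim (\<lambda>lam. eigencurve a b m k lam) at_bot at_top) \<and>
         (\<forall>w. independent_positive (\<lambda>u. - b u u) k w \<longrightarrow>
            filterlim (\<lambda>lam. eigencurve a b m k lam) at_bot at_bot)"
proof (intro conjI allI impI)
  fix v assume "independent_positive (\<lambda>u. b u u) k v"
  with assms show "filterlim (\<lambda>lam. eigencurve a b m k lam) at_bot at_top"
    by (rule eigencurve_tendsto_minus_infinity)
next
  fix w assume w: "independent_positive (\<lambda>u. - b u u) k w"
  define b' where "b' u v = - b u v" for u v
  have "symmetric_bilinear b'"
    using assms(3) by (auto simp: b'_def symmetric_bilinear_def bilinear_def linear_compose_neg)
  moreover have "weakly_continuous_form b'"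
    using assms(6) by (auto simp: b'_def weakly_continuous_form_def intro!: tendsto_minus)
  moreover have "independent_positive (\<lambda>u. b' u u) k w" using w by (simp add: b'_def)
  ultimately have "filterlim (eigencurve a b' m k) at_bot at_top"
    using assms by (intro eigencurve_tendsto_minus_infinity) auto
  then have "filterlim (\<lambda>lam. eigencurve a b' m k (- lam)) at_bot at_bot"
    by (rule filterlim_compose[OF _ filterlim_uminus_at_top_at_bot])
  then show "filterlim (\<lambda>lam. eigencurve a b m k lam) at_bot at_bot"
    unfolding b'_def eigencurve_reflect .
qed

end
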